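(* For any given $\epsilon>0$, the greedy partitioning procedure described in the context generates the minimum number of sub-intervals of $[L_n,U_n]$ required to achieve the performance guarantee of $\frac{1-\epsilon}{1+\epsilon}$, that is: if $K_n$ is the number of sub-intervals generated by the procedure, then there are no $K'_n<K_n$ and points $L_n=d_1<d_2<\dots<d_{K'_n+1}=U_n$ such that $\Phi^{fn}(d_k,d_{k+1})\le\epsilon$ and $\Phi^{gn}(d_k,d_{k+1})\le\epsilon$ for all $k\in[K'_n]$.
   Context: Fix $\sigma_n\in[0,1]$ and $0<L_n<U_n$; $f^n(t)=t^{\sigma_n-1}$, $g^n(t)=t^{\sigma_n}$ on $[L_n,U_n]$. For $L_n\le c<u\le U_n$ and $t\in[c,u]$ let $$\widehat{f^n}(c,u,t)=f^n(c)+\frac{f^n(u)-f^n(c)}{u-c}(t-c),\qquad \widehat{g^n}(c,u,t)=g^n(c)+\frac{g^n(u)-g^n(c)}{u-c}(t-c),$$ and define the maximum relative errors $$\Phi^{fn}(c,u)=\max_{c\le t\le u}\frac{\widehat{f^n}(c,u,t)-f^n(t)}{f^n(t)},\qquad \Phi^{gn}(c,u)=\max_{c\le t\le u}\frac{g^n(t)-\widehat{g^n}(c,u,t)}{g^n(t)}.$$ A partition of $[L_n,U_n]$ achieves the performance guarantee $\frac{1-\epsilon}{1+\epsilon}$ when $\Phi^{fn}\le\epsilon$ and $\Phi^{gn}\le\epsilon$ on each of its sub-intervals. Greedy partitioning procedure: $c^n_1=L_n$; given $c^n_k<U_n$, set $$c^n_{k+1}=\max\{u\in(c^n_k,U_n]:\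 \Phi^{fn}(c^n_k,u)\le\epsilon\ \text{and}\ \Phi^{gn}(c^n_k,u)\le\epsilon\},$$ and stop when $c^n_{k+1}=U_n$; then $K_n=k$. (The paper computes each maximizer by bisection up to a tolerance that is treated as negligible; the procedure is taken here with exact maximizers.) *)

theory Defs
  imports "HOL-Analysis.Analysis"
begin

definition fn :: "real \<Rightarrow> real \<Rightarrow> real" where
  "fn \<sigma> t = t powr (\<sigma> - 1)"

definition gn :: "real \<Rightarrow> real \<Rightarrow> real" where
  "gn \<sigma> t = t powr \<sigma>"

definition chord :: "(real \<Rightarrow> real) \<Rightarrow> real \<Rightarrow> real \<Rightarrow> real \<Rightarrow> real" where
  "chord h c u t = h c + (h u - h c) / (u - c) * (t - c)"

text \<open>The maxima range over infinite sets, so \<open>Max\<close> does not apply; \<open>GREATEST\<close> denotes the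
  greatest element whenever there is one, which \<open>\<Phi>fn_is_max\<close> and \<open>\<Phi>gn_is_max\<close> below guarantee.\<close>

definition \<Phi>fn :: "real \<Rightarrow> real \<Rightarrow> real \<Rightarrow> real" where
  "\<Phi>fn \<sigma> c u = (GREATEST r. r \<in> (\<lambda>t. (chord (fn \<sigma>) c u t - fn \<sigma> t) / fn \<sigma> t) ` {c..u})"

definition \<Phi>gn :: "real \<Rightarrow> real \<Rightarrow> real \<Rightarrow> real" where
  "\<Phi>gn \<sigma> c u = (GREATEST r. r \<in> (\<lambda>t. (gn \<sigma> t - chord (gn \<sigma>) c u t) / gn \<sigma> t) ` {c..u})"

lemma Greatest_continuous_image:
  fixes h :: "real \<Rightarrow> real"
  assumes "c \<le> u" "continuous_on {c..u} h"
  shows "(GREATEST r. r \<in> h ` {c..u}) \<in> h ` {c..u}"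
    and "t \<in> {c..u} \<Longrightarrow> h t \<le> (GREATEST r. r \<in> h ` {c..u})"
proof -
  obtain s where s: "s \<in> {c..u}" "\<And>t. t \<in> {c..u} \<Longrightarrow> h t \<le> h s"
    using continuous_attains_sup[of "{c..u}" h] assms by auto
  have eq: "(GREATEST r. r \<in> h ` {c..u}) = h s"
    by (rule Greatest_equality) (use s in auto)
  show "(GREATEST r. r \<in> h ` {c..u}) \<in> h ` {c..u}"
    unfolding eq using s(1) by (rule imageI)
  show "h t \<le> (GREATEST r. r \<in> h ` {c..u})" if "t \<in> {c..u}"
    unfolding eq using that by (rule s(2))
qed

lemma \<Phi>fn_is_max:
  assumes "0 < c" "c < u"
  shows "\<Phi>fn \<sigma> c u \<in> (\<lambda>t. (chord (fn \<sigma>) c u t - fn \<sigma> t) / fn \<sigma> t) ` {c..u}"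
    and "t \<in> {c..u} \<Longrightarrow> (chord (fn \<sigma>) c u t - fn \<sigma> t) / fn \<sigma> t \<le> \<Phi>fn \<sigma> c u"
proof -
  have "continuous_on {c..u} (\<lambda>t. (chord (fn \<sigma>) c u t - fn \<sigma> t) / fn \<sigma> t)"
    unfolding chord_def fn_def using assms by (intro continuous_intros) auto
  with assms show "\<Phi>fn \<sigma> c u \<in> (\<lambda>t. (chord (fn \<sigma>) c u t - fn \<sigma> t) / fn \<sigma> t) ` {c..u}"
    and "t \<in> {c..u} \<Longrightarrow> (chord (fn \<sigma>) c u t - fn \<sigma> t) / fn \<sigma> t \<le> \<Phi>fn \<sigma> c u"
    unfolding \<Phi>fn_def
    using Greatest_continuous_image[of c u "\<lambda>t. (chord (fn \<sigma>) c u t - fn \<sigma> t) / fn \<sigma> t"]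
    by auto
qed

lemma \<Phi>gn_is_max:
  assumes "0 < c" "c < u"
  shows "\<Phi>gn \<sigma> c u \<in> (\<lambda>t. (gn \<sigma> t - chord (gn \<sigma>) c u t) / gn \<sigma> t) ` {c..u}"
    and "t \<in> {c..u} \<Longrightarrow> (gn \<sigma> t - chord (gn \<sigma>) c u t) / gn \<sigma> t \<le> \<Phi>gn \<sigma> c u"
proof -
  have "continuous_on {c..u} (\<lambda>t. (gn \<sigma> t - chord (gn \<sigma>) c u t) / gn \<sigma> t)"
    unfolding chord_def gn_def using assms by (intro continuous_intros) auto
  with assms show "\<Phi>gn \<sigma> c u \<in> (\<lambda>t. (gn \<sigma> t - chord (gn \<sigma>) c u t) / gn \<sigma> t) ` {c..u}"
    and "t \<in> {c..u} \<Longrightarrow> (gn \<sigma> t - chord (gn \<sigma>) c u t) / gn \<sigma> t \<le> \<Phi>gn \<sigma> c u"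
    unfolding \<Phi>gn_def
    using Greatest_continuous_image[of c u "\<lambda>t. (gn \<sigma> t - chord (gn \<sigma>) c u t) / gn \<sigma> t"]
    by auto
qed

text \<open>Breakpoint sequences are indexed from 1: a partition into \<open>K\<close> sub-intervals is given by
  the values \<open>d 1, \<dots>, d (K + 1)\<close>; all other values of \<open>d\<close> are irrelevant.\<close>

definition guaranteed_partition ::
    "real \<Rightarrow> real \<Rightarrow> real \<Rightarrow> real \<Rightarrow> nat \<Rightarrow> (nat \<Rightarrow> real) \<Rightarrow> bool" where
  "guaranteed_partition \<sigma> L U \<epsilon> K d \<longleftrightarrow>
     d 1 = L \<and> d (K + 1) = U \<and>
     (\<forall>k\<in>{1..K}. d k < d (k + 1) \<and> \<Phi>fn \<sigma> (d k) (d (k + 1)) \<le> \<epsilon> \<and> \<Phi>gn \<sigma> (d k) (d (k + 1)) \<le> \<epsilon>)"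

definition greedy_candidates :: "real \<Rightarrow> real \<Rightarrow> real \<Rightarrow> real \<Rightarrow> real set" where
  "greedy_candidates \<sigma> U \<epsilon> c = {u \<in> {c<..U}. \<Phi>fn \<sigma> c u \<le> \<epsilon> \<and> \<Phi>gn \<sigma> c u \<le> \<epsilon>}"

text \<open>A complete run of the procedure: it starts at \<open>L\<close>, performs a step exactly at the points
  below \<open>U\<close>, each step moving to the greatest candidate, and stops on reaching \<open>U\<close> after
  \<open>K\<close> steps.\<close>

definition greedy_run ::
    "real \<Rightarrow> real \<Rightarrow> real \<Rightarrow> real \<Rightarrow> nat \<Rightarrow> (nat \<Rightarrow> real) \<Rightarrow> bool" where
  "greedy_run \<sigma> L U \<epsilon> K c \<longleftrightarrow>
     c 1 = L \<and>
     (\<forall>k\<in>{1..K}. c k < U \<and>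
        c (k + 1) \<in> greedy_candidates \<sigma> U \<epsilon> (c k) \<and>
        (\<forall>u\<in>greedy_candidates \<sigma> U \<epsilon> (c k). u \<le> c (k + 1))) \<and>
     c (K + 1) = U"

end

theory Submission imports Defs begin

text \<open>
  Since \<open>fn\<close> is convex and \<open>gn\<close> is concave, shrinking an interval moves the chord towards
  the function, so the guarantee is inherited by sub-intervals.  Hence the greedy breakpoints
  stay ahead of those of any other valid partition.  The procedure terminates because
  the guarantee holds on \<open>[c, u]\<close> as soon as \<open>u \<le> (1 + \<epsilon>) c\<close>, so each step either reaches \<open>U\<close> or
  multiplies the breakpoint by at least \<open>1 + \<epsilon>\<close>.
\<close>

section \<open>Chords and their comparison under convexity\<close>

lemma chord_left [simp]: "chord h c u c = h c"
  by (simp add: chord_def)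

lemma chord_right [simp]: "c < u \<Longrightarrow> chord h c u u = h u"
  by (simp add: chord_def)

lemma chord_uminus: "chord (\<lambda>t. - h t) c u t = - chord h c u t"
  by (simp add: chord_def algebra_simps diff_divide_distrib)

text \<open>For \<open>t\<close> between \<open>c\<close> and \<open>u\<close> both weights are
  nonnegative, so the chord is monotone in its two endpoint values. This is the form used in
  \<open>chord_mono\<close>.\<close>

lemma chord_convex_combination:
  assumes "c < u"
  shows "chord h c u t = (u - t) / (u - c) * h c + (t - c) / (u - c) * h u"
proof -
  have "(u - t) / (u - c) = 1 - (t - c) / (u - c)"
    using assms by (simp add: field_simps)
  then show ?thesis
    by (simp add: chord_def algebra_simps diff_divide_distrib)
qed

lemma chord_mono:
  assumes "h c \<le> q c" "h u \<le> q u" "c < u" "t \<in> {c..u}"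
  shows "chord h c u t \<le> chord q c u t"
  unfolding chord_convex_combination[OF \<open>c < u\<close>]
  using assms by (intro add_mono mult_left_mono) auto

text \<open>The chord is an affine function, and an affine function is its own chord over any
  interval.\<close>

lemma chord_chord:
  assumes "c' < u'"
  shows "chord (chord h c u) c' u' t = chord h c u t"
proof -
  define s where "s = (h u - h c) / (u - c)"
  have chord_eq: "chord h c u x = h c + s * (x - c)" for x
    by (simp add: chord_def s_def)
  have "chord h c u u' - chord h c u c' = s * (u' - c')"
    by (simp add: chord_eq algebra_simps)
  then have "chord (chord h c u) c' u' t = chord h c u c' + s * (t - c')"
    using assms by (simp add: chord_def[of "chord h c u"])
  then show ?thesis
    by (simp add: chord_eq algebra_simps)
qed

lemma convex_on_le_chord:
  assumes "convex_on {c..u} h" "t \<in> {c..u}"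
  shows "h t \<le> chord h c u t"
  using convex_onD_Icc'[OF assms] by (simp add: chord_def add.commute)

text \<open>By convexity \<open>h\<close> lies below the long chord at \<open>c'\<close> and
  \<open>u'\<close>. So the short chord lies below the chord that joins these two points of the long
  chord, and by \<open>chord_chord\<close> that is the long chord itself.\<close>

lemma convex_on_chord_subinterval:
  assumes "convex_on {c..u} h" "c \<le> c'" "c' < u'" "u' \<le> u" "t \<in> {c'..u'}"
  shows "chord h c' u' t \<le> chord h c u t"
proof -
  have "chord h c' u' t \<le> chord (chord h c u) c' u' t"
    using assms by (intro chord_mono convex_on_le_chord[OF assms(1)]) auto
  then show ?thesis using assms by (simp add: chord_chord)
qed

lemma concave_on_chord_subinterval:
  assumes "concave_on {c..u} h" "c \<le> c'" "c' < u'" "u' \<le> u" "t \<in> {c'..u'}"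
  shows "chord h c u t \<le> chord h c' u' t"
  using convex_on_chord_subinterval[of c u "\<lambda>t. - h t" c' u' t] assms
  by (simp add: concave_on_def chord_uminus)

section \<open>Curvature of the two power functions\<close>

lemma convex_on_fn:
  assumes "0 < c" "\<sigma> \<le> 1"
  shows "convex_on {c..u} (fn \<sigma>)"
  unfolding fn_def
proof (rule f''_ge0_imp_convex)
  fix x assume "x \<in> {c..u}"
  then have "0 < x" using assms by auto
  then show "((\<lambda>t. t powr (\<sigma> - 1)) has_real_derivative (\<sigma> - 1) * x powr (\<sigma> - 2)) (at x)"
    by (auto intro!: derivative_eq_intros)
  show "((\<lambda>t. (\<sigma> - 1) * t powr (\<sigma> - 2)) has_real_derivative
      (\<sigma> - 1) * (\<sigma> - 2) * x powr (\<sigma> - 3)) (at x)"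
    using \<open>0 < x\<close> by (auto intro!: derivative_eq_intros)
  show "0 \<le> (\<sigma> - 1) * (\<sigma> - 2) * x powr (\<sigma> - 3)"
    using assms by (intro mult_nonneg_nonneg mult_nonpos_nonpos) auto
qed simp

lemma concave_on_gn:
  assumes "0 < c" "0 \<le> \<sigma>" "\<sigma> \<le> 1"
  shows "concave_on {c..u} (gn \<sigma>)"
  unfolding gn_def
proof (rule f''_le0_imp_concave)
  fix x assume "x \<in> {c..u}"
  then have "0 < x" using assms by auto
  then show "((\<lambda>t. t powr \<sigma>) has_real_derivative \<sigma> * x powr (\<sigma> - 1)) (at x)"
    by (auto intro!: derivative_eq_intros)
  show "((\<lambda>t. \<sigma> * t powr (\<sigma> - 1)) has_real_derivative
      \<sigma> * (\<sigma> - 1) * x powr (\<sigma> - 2)) (at x)"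
    using \<open>0 < x\<close> by (auto intro!: derivative_eq_intros)
  show "\<sigma> * (\<sigma> - 1) * x powr (\<sigma> - 2) \<le> 0"
    using assms by (intro mult_nonpos_nonneg mult_nonneg_nonpos) auto
qed simp

section \<open>The guarantee as a pointwise inequality, and its inheritance\<close>

text \<open>The maximum is attained and bounds every relative error; multiplying by
  \<open>fn \<sigma> t > 0\<close> clears the denominator. In the resulting form chords can be
  compared directly and limits can be taken for each \<open>t\<close> separately.\<close>

lemma \<Phi>fn_le_iff:
  assumes "0 < c" "c < u"
  shows "\<Phi>fn \<sigma> c u \<le> \<epsilon> \<longleftrightarrow> (\<forall>t\<in>{c..u}. chord (fn \<sigma>) c u t \<le> (1 + \<epsilon>) * fn \<sigma> t)"
proof -
  let ?e = "\<lambda>t. (chord (fn \<sigma>) c u t - fn \<sigma> t) / fn \<sigma> t"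
  have "?e t \<le> \<epsilon> \<longleftrightarrow> chord (fn \<sigma>) c u t \<le> (1 + \<epsilon>) * fn \<sigma> t" if "t \<in> {c..u}" for t
  proof -
    have "0 < fn \<sigma> t" using that assms by (simp add: fn_def)
    then show ?thesis by (simp add: pos_divide_le_eq algebra_simps)
  qed
  moreover have "\<Phi>fn \<sigma> c u \<le> \<epsilon> \<longleftrightarrow> (\<forall>t\<in>{c..u}. ?e t \<le> \<epsilon>)"
  proof
    show "\<forall>t\<in>{c..u}. ?e t \<le> \<epsilon>" if "\<Phi>fn \<sigma> c u \<le> \<epsilon>"
      using \<Phi>fn_is_max(2)[OF assms] that by (blast intro: order_trans)
    show "\<Phi>fn \<sigma> c u \<le> \<epsilon>" if "\<forall>t\<in>{c..u}. ?e t \<le> \<epsilon>"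
      using \<Phi>fn_is_max(1)[OF assms, of \<sigma>] that by (elim imageE) simp
  qed
  ultimately show ?thesis by simp
qed

lemma \<Phi>gn_le_iff:
  assumes "0 < c" "c < u"
  shows "\<Phi>gn \<sigma> c u \<le> \<epsilon> \<longleftrightarrow> (\<forall>t\<in>{c..u}. (1 - \<epsilon>) * gn \<sigma> t \<le> chord (gn \<sigma>) c u t)"
proof -
  let ?e = "\<lambda>t. (gn \<sigma> t - chord (gn \<sigma>) c u t) / gn \<sigma> t"
  have "?e t \<le> \<epsilon> \<longleftrightarrow> (1 - \<epsilon>) * gn \<sigma> t \<le> chord (gn \<sigma>) c u t" if "t \<in> {c..u}" for t
  proof -
    have "0 < gn \<sigma> t" using that assms by (simp add: gn_def)
    then show ?thesis by (simp add: pos_divide_le_eq algebra_simps)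
  qed
  moreover have "\<Phi>gn \<sigma> c u \<le> \<epsilon> \<longleftrightarrow> (\<forall>t\<in>{c..u}. ?e t \<le> \<epsilon>)"
  proof
    show "\<forall>t\<in>{c..u}. ?e t \<le> \<epsilon>" if "\<Phi>gn \<sigma> c u \<le> \<epsilon>"
      using \<Phi>gn_is_max(2)[OF assms] that by (blast intro: order_trans)
    show "\<Phi>gn \<sigma> c u \<le> \<epsilon>" if "\<forall>t\<in>{c..u}. ?e t \<le> \<epsilon>"
      using \<Phi>gn_is_max(1)[OF assms, of \<sigma>] that by (elim imageE) simp
  qed
  ultimately show ?thesis by simp
qed

text \<open>Over the smaller interval the chord of the convex \<open>fn\<close> drops, while the
  bound \<open>(1 + \<epsilon>) * fn \<sigma> t\<close> stays the same.\<close>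

lemma \<Phi>fn_le_subinterval:
  assumes "\<sigma> \<le> 1" "0 < c" "c \<le> c'" "c' < u'" "u' \<le> u" "\<Phi>fn \<sigma> c u \<le> \<epsilon>"
  shows "\<Phi>fn \<sigma> c' u' \<le> \<epsilon>"
proof -
  have "chord (fn \<sigma>) c' u' t \<le> (1 + \<epsilon>) * fn \<sigma> t" if "t \<in> {c'..u'}" for t
  proof -
    have "chord (fn \<sigma>) c' u' t \<le> chord (fn \<sigma>) c u t"
      using assms that by (intro convex_on_chord_subinterval convex_on_fn) auto
    moreover have "chord (fn \<sigma>) c u t \<le> (1 + \<epsilon>) * fn \<sigma> t"
      using assms that by (simp add: \<Phi>fn_le_iff)
    ultimately show ?thesis by linarith
  qed
  then show ?thesis using assms by (simp add: \<Phi>fn_le_iff)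
qed

lemma \<Phi>gn_le_subinterval:
  assumes "0 \<le> \<sigma>" "\<sigma> \<le> 1" "0 < c" "c \<le> c'" "c' < u'" "u' \<le> u" "\<Phi>gn \<sigma> c u \<le> \<epsilon>"
  shows "\<Phi>gn \<sigma> c' u' \<le> \<epsilon>"
proof -
  have "(1 - \<epsilon>) * gn \<sigma> t \<le> chord (gn \<sigma>) c' u' t" if "t \<in> {c'..u'}" for t
  proof -
    have "chord (gn \<sigma>) c u t \<le> chord (gn \<sigma>) c' u' t"
      using assms that by (intro concave_on_chord_subinterval concave_on_gn) auto
    moreover have "(1 - \<epsilon>) * gn \<sigma> t \<le> chord (gn \<sigma>) c u t"
      using assms that by (simp add: \<Phi>gn_le_iff)
    ultimately show ?thesis by linarith
  qed
  then show ?thesis using assms by (simp add: \<Phi>gn_le_iff)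
qed

section \<open>Intervals of endpoint ratio at most \<open>1 + \<epsilon>\<close>\<close>

lemma chord_const: "chord (\<lambda>_. a) c u t = a"
  by (simp add: chord_def)

text \<open>Since \<open>r \<ge> 1\<close> and \<open>p \<le> 1\<close>,
  \<open>r powr p \<le> r\<close>. It is applied with \<open>p = 1 - \<sigma>\<close> for
  \<open>fn\<close> and with \<open>p = \<sigma>\<close> for \<open>gn\<close>.\<close>

lemma powr_ratio_le:
  fixes c u r p :: real
  assumes "0 < c" "c \<le> u" "u \<le> r * c" "0 \<le> p" "p \<le> 1"
  shows "u powr p \<le> r * c powr p"
proof -
  have r: "1 \<le> r"
    using assms by (smt (verit) mult_less_cancel_right2)
  have "u powr p \<le> (r * c) powr p"
    using assms by (intro powr_mono2) auto
  also have "\<dots> = r powr p * c powr p"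
    using assms r by (simp add: powr_mult)
  also have "\<dots> \<le> r * c powr p"
    using powr_mono[of p 1 r] assms r by (intro mult_right_mono) auto
  finally show ?thesis .
qed

text \<open>As \<open>fn\<close> is nonincreasing, its chord never exceeds the constant
  \<open>fn \<sigma> c\<close>, and the quotient of \<open>fn \<sigma> c\<close> by
  \<open>fn \<sigma> t\<close> is \<open>(t / c) powr (1 - \<sigma>)\<close>, at most
  \<open>1 + \<epsilon>\<close>.\<close>

lemma \<Phi>fn_le_if_ratio_le:
  assumes "0 \<le> \<sigma>" "\<sigma> \<le> 1" "0 < c" "c < u" "u \<le> (1 + \<epsilon>) * c"
  shows "\<Phi>fn \<sigma> c u \<le> \<epsilon>"
proof -
  have "chord (fn \<sigma>) c u t \<le> (1 + \<epsilon>) * fn \<sigma> t" if t: "t \<in> {c..u}" for t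
  proof -
    have decr: "fn \<sigma> y \<le> fn \<sigma> x" if "0 < x" "x \<le> y" for x y
      using that assms by (simp add: fn_def powr_mono2')
    have "chord (fn \<sigma>) c u t \<le> chord (\<lambda>_. fn \<sigma> c) c u t"
      using assms t decr by (intro chord_mono) auto
    also have "\<dots> = fn \<sigma> c"
      by (rule chord_const)
    also have "\<dots> \<le> (1 + \<epsilon>) * fn \<sigma> t"
    proof -
      have "t powr (1 - \<sigma>) \<le> (1 + \<epsilon>) * c powr (1 - \<sigma>)"
        using assms t by (intro powr_ratio_le) auto
      moreover have "fn \<sigma> x = 1 / x powr (1 - \<sigma>)" for x
        using powr_minus_divide[of x "1 - \<sigma>"] by (simp add: fn_def)
      ultimately show ?thesis
        using assms t by (simp add: field_simps)
    qed
    finally show ?thesis .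
  qed
  then show ?thesis using assms by (simp add: \<Phi>fn_le_iff)
qed

lemma \<Phi>gn_le_if_ratio_le:
  assumes "0 \<le> \<sigma>" "\<sigma> \<le> 1" "0 < c" "c < u" "u \<le> (1 + \<epsilon>) * c"
  shows "\<Phi>gn \<sigma> c u \<le> \<epsilon>"
proof -
  have "(1 - \<epsilon>) * gn \<sigma> t \<le> chord (gn \<sigma>) c u t" if t: "t \<in> {c..u}" for t
  proof -
    have incr: "gn \<sigma> x \<le> gn \<sigma> y" if "0 < x" "x \<le> y" for x y
      using that assms by (simp add: gn_def powr_mono2)
    have \<epsilon>: "0 \<le> \<epsilon>"
      using assms by (smt (verit) mult_less_cancel_right2)
    have "gn \<sigma> t \<le> (1 + \<epsilon>) * gn \<sigma> c"
      unfolding gn_def using assms t by (intro powr_ratio_le) auto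
    \<comment> \<open>The sign of \<open>1 - \<epsilon>\<close> is unknown, so the previous bound is
      not multiplied by it; instead \<open>\<epsilon> * gn \<sigma> c\<close> is replaced by the
      larger \<open>\<epsilon> * gn \<sigma> t\<close> and moved to the left.\<close>
    moreover have "\<epsilon> * gn \<sigma> c \<le> \<epsilon> * gn \<sigma> t"
      using \<epsilon> assms t by (intro mult_left_mono incr) auto
    ultimately have "(1 - \<epsilon>) * gn \<sigma> t \<le> gn \<sigma> c"
      by (simp add: algebra_simps)
    also have "\<dots> = chord (\<lambda>_. gn \<sigma> c) c u t"
      by (simp add: chord_const)
    also have "\<dots> \<le> chord (gn \<sigma>) c u t"
      using assms t incr by (intro chord_mono) auto
    finally show ?thesis .
  qed
  then show ?thesis using assms by (simp add: \<Phi>gn_le_iff)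
qed

section \<open>The set of candidates and its maximum\<close>

lemma greedy_candidates_downward_closed:
  assumes "0 \<le> \<sigma>" "\<sigma> \<le> 1" "0 < c" "u \<in> greedy_candidates \<sigma> U \<epsilon> c" "c < v" "v \<le> u"
  shows "v \<in> greedy_candidates \<sigma> U \<epsilon> c"
  using assms \<Phi>fn_le_subinterval[of \<sigma> c c v u \<epsilon>] \<Phi>gn_le_subinterval[of \<sigma> c c v u \<epsilon>]
  by (auto simp: greedy_candidates_def)

text \<open>Serves twice: it makes the candidate set nonempty, and it forces each greedy step to be
  long.\<close>

lemma greedy_candidates_ratio:
  assumes "0 \<le> \<sigma>" "\<sigma> \<le> 1" "0 < c" "c < u" "u \<le> (1 + \<epsilon>) * c" "u \<le> U"
  shows "u \<in> greedy_candidates \<sigma> U \<epsilon> c"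
  using assms by (simp add: greedy_candidates_def \<Phi>fn_le_if_ratio_le \<Phi>gn_le_if_ratio_le)

text \<open>Near \<open>s > c\<close> the denominator \<open>u - c\<close> stays away from zero. The
  limit is taken from the left because candidates are only known below the supremum.\<close>

lemma tendsto_chord:
  assumes "isCont h s" "c < s"
  shows "((\<lambda>u. chord h c u t) \<longlongrightarrow> chord h c s t) (at_left s)"
proof -
  have "isCont (\<lambda>u. chord h c u t) s"
    unfolding chord_def using assms by (intro continuous_intros) auto
  then show ?thesis
    by (metis isCont_def filterlim_at_split)
qed

text \<open>The supremum \<open>s\<close> of the candidates is itself a candidate: everything
  strictly between \<open>c\<close> and \<open>s\<close> is one, and for fixed \<open>t < s\<close>
  the pointwise inequalities survive the limit of the right endpoint to \<open>s\<close>.\<close>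

lemma greedy_candidates_has_max:
  assumes "0 \<le> \<sigma>" "\<sigma> \<le> 1" "0 < c" "c < U" "\<epsilon> > 0"
  obtains s where "s \<in> greedy_candidates \<sigma> U \<epsilon> c"
    and "\<And>u. u \<in> greedy_candidates \<sigma> U \<epsilon> c \<Longrightarrow> u \<le> s"
proof -
  let ?S = "greedy_candidates \<sigma> U \<epsilon> c"
  have S: "c < u \<and> u \<le> U" if "u \<in> ?S" for u
    using that by (auto simp: greedy_candidates_def)
  have "min U ((1 + \<epsilon>) * c) \<in> ?S"
    using assms by (intro greedy_candidates_ratio) auto
  then have ne: "?S \<noteq> {}" by blast
  have bdd: "bdd_above ?S" using S by (meson bdd_aboveI)
  define s where "s = Sup ?S"
  have ub: "u \<le> s" if "u \<in> ?S" for u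
    unfolding s_def using that bdd by (rule cSup_upper)
  have "c < s"
    using ne S ub by (meson ex_in_conv less_le_trans)
  moreover have "s \<le> U"
    unfolding s_def using ne S by (intro cSup_least) auto
  ultimately have s: "c < s" "s \<le> U" by auto
  have below: "u \<in> ?S" if "c < u" "u < s" for u
  proof -
    obtain v where "v \<in> ?S" "u < v"
      using \<open>u < s\<close> less_cSup_iff[OF ne bdd, of u] by (auto simp: s_def)
    then show ?thesis
      using greedy_candidates_downward_closed[of \<sigma> c v U \<epsilon> u] assms(1-3) \<open>c < u\<close> by simp
  qed
  \<comment> \<open>The inequality at \<open>t\<close> is available for the candidate
    \<open>u\<close> only if \<open>t\<close> lies in \<open>{c..u}\<close>, hence the condition
    \<open>t < u\<close>.\<close>
  have ev: "\<forall>\<^sub>F u in at_left s. t < u \<and> u \<in> ?S" if "t \<in> {c..<s}" for t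
    using that below by (intro eventually_at_leftI[of t]) auto
  have f: "chord (fn \<sigma>) c s t \<le> (1 + \<epsilon>) * fn \<sigma> t" if t: "t \<in> {c..<s}" for t
  proof (rule tendsto_upperbound)
    show "((\<lambda>u. chord (fn \<sigma>) c u t) \<longlongrightarrow> chord (fn \<sigma>) c s t) (at_left s)"
      using s assms unfolding fn_def by (intro tendsto_chord continuous_intros) auto
    show "\<forall>\<^sub>F u in at_left s. chord (fn \<sigma>) c u t \<le> (1 + \<epsilon>) * fn \<sigma> t"
      using ev[OF t]
    proof eventually_elim
      case (elim u)
      then show ?case using t assms by (auto simp: greedy_candidates_def \<Phi>fn_le_iff)
    qed
  qed simp
  have g: "(1 - \<epsilon>) * gn \<sigma> t \<le> chord (gn \<sigma>) c s t" if t: "t \<in> {c..<s}" for t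
  proof (rule tendsto_lowerbound)
    show "((\<lambda>u. chord (gn \<sigma>) c u t) \<longlongrightarrow> chord (gn \<sigma>) c s t) (at_left s)"
      using s assms unfolding gn_def by (intro tendsto_chord continuous_intros) auto
    show "\<forall>\<^sub>F u in at_left s. (1 - \<epsilon>) * gn \<sigma> t \<le> chord (gn \<sigma>) c u t"
      using ev[OF t]
    proof eventually_elim
      case (elim u)
      then show ?case using t assms by (auto simp: greedy_candidates_def \<Phi>gn_le_iff)
    qed
  qed simp
  \<comment> \<open>The limit does not cover \<open>t = s\<close>, but there the chord meets the
    function and the bound reduces to \<open>\<epsilon> \<ge> 0\<close>; likewise for
    \<open>gn\<close> below.\<close>
  have "\<Phi>fn \<sigma> c s \<le> \<epsilon>"
    unfolding \<Phi>fn_le_iff[OF \<open>0 < c\<close> \<open>c < s\<close>]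
  proof
    fix t assume "t \<in> {c..s}"
    then show "chord (fn \<sigma>) c s t \<le> (1 + \<epsilon>) * fn \<sigma> t"
      using f[of t] s assms by (cases "t = s") (auto simp: fn_def algebra_simps)
  qed
  moreover have "\<Phi>gn \<sigma> c s \<le> \<epsilon>"
    unfolding \<Phi>gn_le_iff[OF \<open>0 < c\<close> \<open>c < s\<close>]
  proof
    fix t assume "t \<in> {c..s}"
    then show "(1 - \<epsilon>) * gn \<sigma> t \<le> chord (gn \<sigma>) c s t"
      using g[of t] s assms by (cases "t = s") (auto simp: gn_def algebra_simps)
  qed
  ultimately have "s \<in> ?S" using s by (simp add: greedy_candidates_def)
  then show ?thesis using ub that by blast
qed

section \<open>Termination of the greedy procedure\<close>

lemma greedy_run_exists:
  assumes "0 \<le> \<sigma>" "\<sigma> \<le> 1" "0 < L" "L < U" "\<epsilon> > 0"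
  shows "\<exists>K c. greedy_run \<sigma> L U \<epsilon> K c"
proof -
  \<comment> \<open>The implication holds for every real \<open>c\<close>, so a total function
    \<open>step\<close> can be chosen; its values outside the range \<open>0 < c < U\<close> are
    arbitrary.\<close>
  have "\<exists>s. 0 < c \<and> c < U \<longrightarrow>
      s \<in> greedy_candidates \<sigma> U \<epsilon> c \<and> (\<forall>u\<in>greedy_candidates \<sigma> U \<epsilon> c. u \<le> s)" for c
    using greedy_candidates_has_max[of \<sigma> c U \<epsilon>] assms by metis
  then obtain step where step: "\<And>c. 0 < c \<Longrightarrow> c < U \<Longrightarrow>
      step c \<in> greedy_candidates \<sigma> U \<epsilon> c \<and> (\<forall>u\<in>greedy_candidates \<sigma> U \<epsilon> c. u \<le> step c)"
    by metis
  define b where "b k = (step ^^ k) L" for k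
  have b_Suc: "b (Suc k) = step (b k)" for k by (simp add: b_def)
  \<comment> \<open>Breakpoints grow at least geometrically until they are capped by
    \<open>U\<close>. The premise keeps earlier iterates away from \<open>U\<close>, where
    \<open>step\<close> is unspecified.\<close>
  have growth: "b k \<le> U \<and> min U (L * (1 + \<epsilon>) ^ k) \<le> b k" if "\<forall>j<k. b j \<noteq> U" for k
    using that
  proof (induction k)
    case 0
    then show ?case using assms by (simp add: b_def)
  next
    case (Suc k)
    then have "b k \<le> U" "b k \<noteq> U" "min U (L * (1 + \<epsilon>) ^ k) \<le> b k" by auto
    then have IH: "b k < U" "L * (1 + \<epsilon>) ^ k \<le> b k" by linarith+
    moreover have "0 < L * (1 + \<epsilon>) ^ k" using assms by simp
    ultimately have pos: "0 < b k" by linarith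
    note st = step[OF pos IH(1)]
    have "min U ((1 + \<epsilon>) * b k) \<in> greedy_candidates \<sigma> U \<epsilon> (b k)"
      using assms IH pos by (intro greedy_candidates_ratio) auto
    then have "min U ((1 + \<epsilon>) * b k) \<le> b (Suc k)"
      using st by (auto simp: b_Suc)
    moreover have "L * (1 + \<epsilon>) ^ Suc k \<le> (1 + \<epsilon>) * b k"
      using mult_left_mono[OF IH(2), of "1 + \<epsilon>"] assms by (simp add: mult_ac)
    moreover have "b (Suc k) \<le> U"
      using st by (simp add: b_Suc greedy_candidates_def)
    ultimately show ?case by linarith
  qed
  have "\<exists>k. b k = U"
  proof (rule ccontr)
    assume "\<nexists>k. b k = U"
    then have "b k \<le> U" "b k \<noteq> U" "min U (L * (1 + \<epsilon>) ^ k) \<le> b k" for k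
      using growth[of k] by auto
    \<comment> \<open>If \<open>U\<close> is never reached, every \<open>b k\<close> is strictly
      below \<open>U\<close>, so the minimum must be its second argument; unbounded powers then give
      the contradiction.\<close>
    then have "L * (1 + \<epsilon>) ^ k < U" for k
      by (metis le_less_trans less_le min_less_iff_conj not_le)
    moreover obtain k where "U / L < (1 + \<epsilon>) ^ k"
      using real_arch_pow[of "1 + \<epsilon>" "U / L"] assms by auto
    ultimately show False
      using \<open>0 < L\<close> by (metis less_asym mult.commute pos_divide_less_eq)
  qed
  \<comment> \<open>The least such index ensures that all earlier iterates lie below
    \<open>U\<close>.\<close>
  then obtain K where K: "b K = U" "\<forall>j<K. b j \<noteq> U"
    using exists_least_iff[of "\<lambda>k. b k = U"] by auto
  have inside: "0 < b j \<and> b j < U" if "j < K" for j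
  proof -
    have "0 < L * (1 + \<epsilon>) ^ j" using assms by simp
    moreover have "b j \<noteq> U" "b j \<le> U \<and> min U (L * (1 + \<epsilon>) ^ j) \<le> b j"
      using growth[of j] K(2) that by auto
    ultimately show ?thesis using assms by linarith
  qed
  \<comment> \<open>Iterates count from 0 and breakpoints from 1, hence the shift.\<close>
  have "greedy_run \<sigma> L U \<epsilon> K (\<lambda>k. b (k - 1))"
    unfolding greedy_run_def
  proof (intro conjI ballI)
    fix k assume "k \<in> {1..K}"
    then obtain j where j: "k = Suc j" "j < K" by (cases k) auto
    show "b (k - 1) < U" using j inside by simp
    show "b (k + 1 - 1) \<in> greedy_candidates \<sigma> U \<epsilon> (b (k - 1))"
      using j inside[of j] step[of "b j"] by (simp add: b_Suc)
    show "u \<le> b (k + 1 - 1)" if "u \<in> greedy_candidates \<sigma> U \<epsilon> (b (k - 1))" for u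
      using that j inside[of j] step[of "b j"] by (simp add: b_Suc)
  qed (use K in \<open>auto simp: b_def\<close>)
  then show ?thesis by blast
qed

section \<open>Minimality of the greedy partition\<close>

lemma greedy_run_guaranteed_partition:
  "greedy_run \<sigma> L U \<epsilon> K c \<Longrightarrow> guaranteed_partition \<sigma> L U \<epsilon> K c"
  by (auto simp: greedy_run_def guaranteed_partition_def greedy_candidates_def)

text \<open>The lower bound makes all breakpoints positive when \<open>L > 0\<close>; the upper
  bound is what membership in \<open>greedy_candidates\<close> asks for.\<close>

lemma guaranteed_partition_bounds:
  assumes part: "guaranteed_partition \<sigma> L U \<epsilon> K d" and k: "1 \<le> k" "k \<le> K + 1"
  shows "L \<le> d k" "d k \<le> U"
proof -
  have ends: "d 1 = L" "d (K + 1) = U"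
    and incr: "\<And>j. 1 \<le> j \<Longrightarrow> j \<le> K \<Longrightarrow> d j \<le> d (Suc j)"
    using part by (auto simp: guaranteed_partition_def less_imp_le)
  show "L \<le> d k"
    using k
  proof (induction k rule: dec_induct)
    case base
    show ?case by (simp only: ends order_refl)
  next
    case (step n)
    then show ?case using incr[of n] by simp
  qed
  show "d k \<le> U"
    using k(2,1)
  proof (induction k rule: inc_induct)
    case base
    show ?case by (simp only: ends order_refl)
  next
    case (step n)
    then show ?case using incr[of n] by simp
  qed
qed

lemma greedy_run_ahead:
  assumes "0 \<le> \<sigma>" "\<sigma> \<le> 1" "0 < L"
    and run: "greedy_run \<sigma> L U \<epsilon> K c"
    and part: "guaranteed_partition \<sigma> L U \<epsilon> K' d"
    and "1 \<le> k" "k \<le> K + 1" "k \<le> K' + 1"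
  shows "d k \<le> c k"
  using \<open>1 \<le> k\<close> \<open>k \<le> K + 1\<close> \<open>k \<le> K' + 1\<close>
proof (induction k rule: dec_induct)
  case base
  then show ?case using run part by (simp add: greedy_run_def guaranteed_partition_def)
next
  case (step k)
  then have IH: "d k \<le> c k" and k: "k \<in> {1..K}" "k \<in> {1..K'}" by auto
  show ?case
  proof (cases "d (Suc k) \<le> c k")
    case True
    moreover have "c k < c (Suc k)"
      using run k by (auto simp: greedy_run_def greedy_candidates_def)
    ultimately show ?thesis by linarith
  next
    case False
    have "0 < d k" "d (Suc k) \<le> U"
      using guaranteed_partition_bounds[OF part, of k]
        guaranteed_partition_bounds[OF part, of "Suc k"] k assms(3) by auto
    moreover have "\<Phi>fn \<sigma> (d k) (d (Suc k)) \<le> \<epsilon>" "\<Phi>gn \<sigma> (d k) (d (Suc k)) \<le> \<epsilon>"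
      using part k by (auto simp: guaranteed_partition_def)
    \<comment> \<open>Here \<open>d k \<le> c k < d (Suc k)\<close>, so the interval from
      \<open>c k\<close> to \<open>d (Suc k)\<close> is part of a sub-interval of the other
      partition and inherits its guarantee. The greedy choice then goes at least as far.\<close>
    ultimately have "d (Suc k) \<in> greedy_candidates \<sigma> U \<epsilon> (c k)"
      using False IH assms(1,2) \<Phi>fn_le_subinterval[of \<sigma> "d k" "c k" "d (Suc k)" "d (Suc k)" \<epsilon>]
        \<Phi>gn_le_subinterval[of \<sigma> "d k" "c k" "d (Suc k)" "d (Suc k)" \<epsilon>]
      by (simp add: greedy_candidates_def)
    then show ?thesis using run k by (simp add: greedy_run_def)
  qed
qed

theorem theorem3:
  fixes \<sigma> L U \<epsilon> :: real
  assumes "0 \<le> \<sigma>" and "\<sigma> \<le> 1" and "0 < L" and "L < U" and "\<epsilon> > 0"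
  shows "(\<exists>K c. greedy_run \<sigma> L U \<epsilon> K c) \<and>
         (\<forall>K c. greedy_run \<sigma> L U \<epsilon> K c \<longrightarrow>
            guaranteed_partition \<sigma> L U \<epsilon> K c \<and>
            \<not> (\<exists>K' d. K' < K \<and> guaranteed_partition \<sigma> L U \<epsilon> K' d))"
proof (intro conjI allI impI notI)
  show "\<exists>K c. greedy_run \<sigma> L U \<epsilon> K c"
    using assms by (rule greedy_run_exists)
next
  fix K c assume run: "greedy_run \<sigma> L U \<epsilon> K c"
  then show "guaranteed_partition \<sigma> L U \<epsilon> K c"
    by (rule greedy_run_guaranteed_partition)
  assume "\<exists>K' d. K' < K \<and> guaranteed_partition \<sigma> L U \<epsilon> K' d"
  then obtain K' d where K': "K' < K" and part: "guaranteed_partition \<sigma> L U \<epsilon> K' d"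
    by blast
  have "U = d (K' + 1)"
    using part by (simp add: guaranteed_partition_def)
  also have "\<dots> \<le> c (K' + 1)"
    using greedy_run_ahead[OF assms(1-3) run part, of "K' + 1"] K' by simp
  \<comment> \<open>As \<open>K' + 1 \<le> K\<close>, the run still performs a step at
    \<open>c (K' + 1)\<close>.\<close>
  also have "\<dots> < U"
    using run K' by (auto simp: greedy_run_def)
  finally show False by simp
qed

end
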